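(* Let $A>0$, $\alpha>0$, $\gamma>1$ and $\delta\ge0$. Then, for the Cauchy problem (CP) (stated in the context), there is no classical solution $(\rho,u)\in D(\infty)$ satisfying $$\limsup_{t\to\infty}\|u(t,\cdot)\|_{L^\infty(\mathbb R)}=0.$$
   Context: The Cauchy problem (CP) is the 1-D isentropic compressible Navier–Stokes system $$\rho_t+(\rho u)_x=0,\qquad (\rho u)_t+(\rho u^2)_x+P(\rho)_x=(\mu(\rho)u_x)_x,$$ with mass density $\rho\ge0$, velocity $u$, $P(\rho)=A\rho^\gamma$, $\mu(\rho)=\alpha\rho^\delta$, initial data $(\rho,u)(0,x)=(\rho_0,u_0)(x)$ for $x\in\mathbb R$, and far field behavior $(\rho,u)(t,x)\to(0,0)$ as $|x|\to\infty$ for $t\ge0$. Define the total mass $m(t)=\int_{\mathbb R}\rho(t,x)\,dx$, the momentum $\mathbb P(t)=\int_{\mathbb R}\rho(t,x)u(t,x)\,dx$, and the kinetic energy $E_k(t)=\frac12\int_{\mathbb R}\rho(t,x)u^2(t,x)\,dx$. For $T>0$, a classical solution $(\rho,u)$ of (CP) is said to be in $D(T)$ if, for any $t\in[0,T]$: (A) $0<m(0)=m(t)<\infty$ (conservation of total mass); (B) $0<|\mathbb P(0)|=|\mathbb P(t)|<\infty$ (conservation of momentum); (C) $0<E_k(t)<\infty$ (finite kinetic energy). $D(\infty)$ denotes the class of global-in-time classical solutions satisfying (A), (B), (C) for all $t\in[0,\infty)$. *)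

theory Defs
  imports "HOL-Probability.Essential_Supremum"
begin

text \<open>
  Space-time functions are curried, time first: \<open>f t x\<close> with \<open>t \<in> time_dom T\<close> and \<open>x \<in> \<real>\<close>.
  Their values at other times are irrelevant, so time derivatives are taken within the time
  interval. The end time may be \<open>\<infinity>\<close>, in which case the interval is \<open>{0..}\<close>.
\<close>

definition time_dom :: "ereal \<Rightarrow> real set" where
  "time_dom T = {t. 0 \<le> t \<and> ereal t \<le> T}"

definition dt :: "ereal \<Rightarrow> (real \<Rightarrow> real \<Rightarrow> real) \<Rightarrow> real \<Rightarrow> real \<Rightarrow> real" where
  "dt T f t x = vector_derivative (\<lambda>s. f s x) (at t within time_dom T)"

definition dx :: "(real \<Rightarrow> real \<Rightarrow> real) \<Rightarrow> real \<Rightarrow> real \<Rightarrow> real" where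
  "dx f t x = deriv (f t) x"

definition continuous_dt :: "ereal \<Rightarrow> (real \<Rightarrow> real \<Rightarrow> real) \<Rightarrow> bool" where
  "continuous_dt T f \<longleftrightarrow>
     (\<forall>t\<in>time_dom T - {0}. \<forall>x. (\<lambda>s. f s x) differentiable (at t within time_dom T)) \<and>
     continuous_on ((time_dom T - {0}) \<times> UNIV) (\<lambda>(t, x). dt T f t x)"

definition continuous_dx :: "ereal \<Rightarrow> (real \<Rightarrow> real \<Rightarrow> real) \<Rightarrow> bool" where
  "continuous_dx T f \<longleftrightarrow>
     (\<forall>t\<in>time_dom T - {0}. \<forall>x. f t differentiable (at x)) \<and>
     continuous_on ((time_dom T - {0}) \<times> UNIV) (\<lambda>(t, x). dx f t x)"

definition pressure :: "real \<Rightarrow> real \<Rightarrow> real \<Rightarrow> real" where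
  "pressure A \<gamma> r = A * r powr \<gamma>"

text \<open>For \<open>\<delta> = 0\<close> the viscosity is the constant \<open>\<alpha>\<close>, also in vacuum. The case distinction is
  needed since \<open>0 powr 0 = 0\<close>.\<close>

definition viscosity :: "real \<Rightarrow> real \<Rightarrow> real \<Rightarrow> real" where
  "viscosity \<alpha> \<delta> r = (if \<delta> = 0 then \<alpha> else \<alpha> * r powr \<delta>)"

text \<open>
  Classical solutions on \<open>[0, T]\<close> (on \<open>[0, \<infinity>)\<close> if \<open>T = \<infinity>\<close>): \<open>\<rho>\<close> and \<open>u\<close> are continuous up to
  \<open>t = 0\<close>, where they take the initial values, and for positive times they are continuously
  differentiable and satisfy the equations pointwise. As vacuum is allowed, \<open>\<mu>(\<rho>)\<close> need not be
  differentiable for \<open>\<delta> < 1\<close>; hence the second-order regularity is imposed on the viscous flux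
  \<open>\<mu>(\<rho>) u\<^sub>x\<close>, which is what the system differentiates, and not on \<open>u\<close>.
\<close>

definition classical_solution ::
  "real \<Rightarrow> real \<Rightarrow> real \<Rightarrow> real \<Rightarrow> (real \<Rightarrow> real) \<Rightarrow> (real \<Rightarrow> real) \<Rightarrow> ereal \<Rightarrow>
   (real \<Rightarrow> real \<Rightarrow> real) \<Rightarrow> (real \<Rightarrow> real \<Rightarrow> real) \<Rightarrow> bool" where
  "classical_solution A \<alpha> \<gamma> \<delta> \<rho>\<^sub>0 u\<^sub>0 T \<rho> u \<longleftrightarrow>
     \<comment> \<open>regularity\<close>
     continuous_on (time_dom T \<times> UNIV) (\<lambda>(t, x). \<rho> t x) \<and>
     continuous_on (time_dom T \<times> UNIV) (\<lambda>(t, x). u t x) \<and>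
     continuous_dt T \<rho> \<and> continuous_dx T \<rho> \<and>
     continuous_dt T u \<and> continuous_dx T u \<and>
     continuous_dx T (\<lambda>t x. viscosity \<alpha> \<delta> (\<rho> t x) * dx u t x) \<and>
     (\<forall>t\<in>time_dom T. \<forall>x. 0 \<le> \<rho> t x) \<and>
     \<comment> \<open>conservation of mass and balance of momentum\<close>
     (\<forall>t\<in>time_dom T - {0}. \<forall>x.
        dt T \<rho> t x + dx (\<lambda>t x. \<rho> t x * u t x) t x = 0) \<and>
     (\<forall>t\<in>time_dom T - {0}. \<forall>x.
        dt T (\<lambda>t x. \<rho> t x * u t x) t x + dx (\<lambda>t x. \<rho> t x * (u t x)\<^sup>2) t x
          + dx (\<lambda>t x. pressure A \<gamma> (\<rho> t x)) t x
        = dx (\<lambda>t x. viscosity \<alpha> \<delta> (\<rho> t x) * dx u t x) t x) \<and>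
     \<comment> \<open>initial data and far field behaviour\<close>
     (\<forall>x. \<rho> 0 x = \<rho>\<^sub>0 x \<and> u 0 x = u\<^sub>0 x) \<and>
     (\<forall>t\<in>time_dom T. (\<rho> t \<longlongrightarrow> 0) at_infinity \<and> (u t \<longlongrightarrow> 0) at_infinity)"

definition mass :: "(real \<Rightarrow> real \<Rightarrow> real) \<Rightarrow> real \<Rightarrow> real" where
  "mass \<rho> t = (LINT x|lborel. \<rho> t x)"

definition momentum :: "(real \<Rightarrow> real \<Rightarrow> real) \<Rightarrow> (real \<Rightarrow> real \<Rightarrow> real) \<Rightarrow> real \<Rightarrow> real" where
  "momentum \<rho> u t = (LINT x|lborel. \<rho> t x * u t x)"

definition kinetic_energy :: "(real \<Rightarrow> real \<Rightarrow> real) \<Rightarrow> (real \<Rightarrow> real \<Rightarrow> real) \<Rightarrow> real \<Rightarrow> real" where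
  "kinetic_energy \<rho> u t = 1 / 2 * (LINT x|lborel. \<rho> t x * (u t x)\<^sup>2)"

text \<open>The class \<open>D(T)\<close>. Finiteness of the mass, momentum and kinetic energy is integrability of
  the respective densities, because non-integrable functions have Bochner integral 0.\<close>

definition class_D ::
  "real \<Rightarrow> real \<Rightarrow> real \<Rightarrow> real \<Rightarrow> (real \<Rightarrow> real) \<Rightarrow> (real \<Rightarrow> real) \<Rightarrow> ereal \<Rightarrow>
   ((real \<Rightarrow> real \<Rightarrow> real) \<times> (real \<Rightarrow> real \<Rightarrow> real)) set" where
  "class_D A \<alpha> \<gamma> \<delta> \<rho>\<^sub>0 u\<^sub>0 T = {(\<rho>, u).
     0 < T \<and> classical_solution A \<alpha> \<gamma> \<delta> \<rho>\<^sub>0 u\<^sub>0 T \<rho> u \<and>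
     (\<forall>t\<in>time_dom T.
        (integrable lborel (\<rho> t) \<and> 0 < mass \<rho> 0 \<and> mass \<rho> 0 = mass \<rho> t) \<and>
        (integrable lborel (\<lambda>x. \<rho> t x * u t x) \<and>
           0 < \<bar>momentum \<rho> u 0\<bar> \<and> \<bar>momentum \<rho> u 0\<bar> = \<bar>momentum \<rho> u t\<bar>) \<and>
        (integrable lborel (\<lambda>x. \<rho> t x * (u t x)\<^sup>2) \<and> 0 < kinetic_energy \<rho> u t))}"

definition Linf_norm :: "(real \<Rightarrow> real) \<Rightarrow> ereal" where
  "Linf_norm f = esssup lborel (\<lambda>x. ereal \<bar>f x\<bar>)"

end

theory Submission
  imports Defs
begin

text \<open>
  Since \<open>\<bar>\<P>(t)\<bar> \<le> \<parallel>u(t)\<parallel>\<^sub>\<infinity> m(t)\<close>, conservation of mass and momentum bounds \<open>\<parallel>u(t)\<parallel>\<^sub>\<infinity>\<close> from below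
  by the positive constant \<open>\<bar>\<P>(0)\<bar> / m(0)\<close>.
\<close>

lemma abs_momentum_le:
  assumes rho: "integrable lborel (\<rho> t)" and rho_u: "integrable lborel (\<lambda>x. \<rho> t x * u t x)"
    and nonneg: "\<And>x. 0 \<le> \<rho> t x" and norm: "Linf_norm (u t) \<le> ereal c"
  shows "\<bar>momentum \<rho> u t\<bar> \<le> c * mass \<rho> t"
proof -
  \<comment> \<open>No measurability of \<open>u t\<close> is required: \<open>esssup\<close> takes
    the value \<open>\<infinity>\<close> on non-measurable functions, so the bound then holds
    trivially.\<close>
  have "AE x in lborel. ereal \<bar>u t x\<bar> \<le> Linf_norm (u t)"
    unfolding Linf_norm_def by (rule esssup_AE)
  then have bound: "AE x in lborel. \<bar>\<rho> t x * u t x\<bar> \<le> c * \<rho> t x"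
  proof eventually_elim
    case (elim x)
    then have "\<bar>u t x\<bar> \<le> c"
      using norm by (metis ereal_less_eq(3) order_trans)
    then show ?case
      using nonneg[of x] by (simp add: abs_mult mult.commute[of c] mult_left_mono)
  qed
  have "\<bar>momentum \<rho> u t\<bar> \<le> (LINT x|lborel. \<bar>\<rho> t x * u t x\<bar>)"
    unfolding momentum_def by (rule integral_abs_bound)
  also have "\<dots> \<le> (LINT x|lborel. c * \<rho> t x)"
    using rho rho_u bound by (intro integral_mono_AE) auto
  finally show ?thesis
    by (simp add: mass_def)
qed

theorem theorem1p3:
  fixes A \<alpha> \<gamma> \<delta> :: real and \<rho>\<^sub>0 u\<^sub>0 :: "real \<Rightarrow> real"
  assumes "A > 0" and "\<alpha> > 0" and "\<gamma> > 1" and "\<delta> \<ge> 0"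
  shows "\<not> (\<exists>\<rho> u. (\<rho>, u) \<in> class_D A \<alpha> \<gamma> \<delta> \<rho>\<^sub>0 u\<^sub>0 \<infinity> \<and>
              Limsup at_top (\<lambda>t. Linf_norm (u t)) = 0)"
proof clarify
  fix \<rho> u
  assume D: "(\<rho>, u) \<in> class_D A \<alpha> \<gamma> \<delta> \<rho>\<^sub>0 u\<^sub>0 \<infinity>"
    and lim: "Limsup at_top (\<lambda>t. Linf_norm (u t)) = 0"
  have props: "integrable lborel (\<rho> t)" "integrable lborel (\<lambda>x. \<rho> t x * u t x)"
    "mass \<rho> t = mass \<rho> 0" "\<bar>momentum \<rho> u t\<bar> = \<bar>momentum \<rho> u 0\<bar>" "\<And>x. 0 \<le> \<rho> t x"
    "0 < mass \<rho> 0" "0 < \<bar>momentum \<rho> u 0\<bar>" if "0 \<le> t" for t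
    using D that by (auto simp: class_D_def classical_solution_def time_dom_def)
  \<comment> \<open>Half of the lower bound for the norm: positive, hence above the limsup, yet
    small enough that \<open>c * mass \<rho> 0\<close> is only half of the momentum.\<close>
  define c where "c = \<bar>momentum \<rho> u 0\<bar> / (2 * mass \<rho> 0)"
  have "0 < c"
    using props(6,7)[of 0] by (simp add: c_def)
  then have "Limsup at_top (\<lambda>t. Linf_norm (u t)) < ereal c"
    by (simp add: lim)
  then have "\<forall>\<^sub>F t in at_top. Linf_norm (u t) < ereal c"
    by (rule Limsup_lessD)
  \<comment> \<open>The conservation laws constrain nonnegative times only, so the chosen time must
    be one of these.\<close>
  then have "\<forall>\<^sub>F t in at_top. 0 \<le> t \<and> Linf_norm (u t) < ereal c"
    using eventually_ge_at_top[of "0::real"] by (simp add: eventually_conj_iff)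
  then obtain t where t: "0 \<le> t" "Linf_norm (u t) < ereal c"
    using eventually_happens'[OF trivial_limit_at_top_linorder] by blast
  have "\<bar>momentum \<rho> u 0\<bar> \<le> c * mass \<rho> 0"
    using abs_momentum_le[of \<rho> t u c] props[OF t(1)] t(2) by simp
  \<comment> \<open>By the choice of \<open>c\<close> the estimate reads \<open>\<bar>momentum
    \<rho> u 0\<bar> \<le> \<bar>momentum \<rho> u 0\<bar> / 2\<close>, which is absurd for a
    nonzero momentum.\<close>
  then show False
    using props(6,7)[of 0] by (simp add: c_def)
qed

end
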